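(* Let $\mathbb{L}$ be the algebra of paracomplex numbers, let $\Omega\subset\mathbb{L}$ be a simply connected domain, let $h:\Omega\to\mathbb{R}$ be a (smooth) harmonic function and let $L,P:\Omega\to\mathbb{L}$ be two (smooth) $\mathbb{L}$-differentiable functions such that $$(h_z)^2=L_z\,P_z\qquad\text{and}\qquad 2\,h_z\,\overline{h_z}+L_z\,\overline{L_z}+P_z\,\overline{P_z}\neq 0$$ at every point of $\Omega$. Then the map $\psi:\Omega\to\mathbb{R}\times\mathbb{L}$ given by $\psi(z)=(h(z),\,L(z)-\overline{P(z)})$ defines a conformal timelike minimal immersion into the Lorentz-Minkowski space $\mathbb{L}^3$.
   Context: The paracomplex (Lorentz) numbers are $\mathbb{L}=\{a+\tau\,b : a,b\in\mathbb{R}\}$, where $\tau^2=1$, with the obvious addition and multiplication, conjugation $\overline{a+\tau\,b}=a-\tau\,b$, and the topology of $\mathbb{R}^2$. For $z=u+\tau\,v$, put $$\frac{\partial}{\partial z}=\frac12\left(\frac{\partial}{\partial u}+\tau\,\frac{\partial}{\partial v}\right),\qquad \frac{\partial}{\partial\bar z}=\frac12\left(\frac{\partial}{\partial u}-\tau\,\frac{\partial}{\partial v}\right);$$ subscripts $z$ denote the operator $\partial/\partial z$. A $C^1$ function $f=a+\tau\,b:\Omega\to\mathbb{L}$ (with $a,b$ real valued) is $\mathbb{L}$-differentiable ($\mathbb{L}$-holomorphic) in $\Omega$ if and only if $\partial f/\partial\bar z=0$ in $\Omega$, i.e. $a_u=b_v$ and $a_v=b_u$. A function $h:\Omega\to\mathbb{R}$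 is harmonic if $h_{uu}-h_{vv}=0$. $\mathbb{L}^3$ is $\mathbb{R}^3$ endowed with the Lorentzian metric $g=dx_1^2+dx_2^2-dx_3^2$, identified with $\mathbb{R}\times\mathbb{L}$ by $(x_1,x_2,x_3)\leftrightarrow(x_1,\,x_2+\tau\,x_3)$. An immersion $\psi:\Omega\to\mathbb{L}^3$ is timelike if the induced metric $ds^2=\psi^*g$ is Lorentzian. It is conformal if $z=u+\tau\,v$ is an isothermal coordinate for $ds^2$, i.e. $g(\psi_u,\psi_u)=-g(\psi_v,\psi_v)$ and $g(\psi_u,\psi_v)=0$. It is minimal if its mean curvature (the trace of the second fundamental form with respect to the first fundamental form, computed with a unit normal field $N$, $g(N,N)=1$) vanishes identically. *)

theory Defs
  imports "HOL-Analysis.Analysis"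
begin

section \<open>Paracomplex numbers\<close>

codatatype paracomplex = Paracomplex (PRe: real) (PIm: real)

lemma paracomplex_eq_iff: "x = y \<longleftrightarrow> PRe x = PRe y \<and> PIm x = PIm y"
  by (auto intro: paracomplex.expand)

instantiation paracomplex :: comm_ring_1
begin

primcorec zero_paracomplex where
  "PRe 0 = 0"
| "PIm 0 = 0"

primcorec one_paracomplex where
  "PRe 1 = 1"
| "PIm 1 = 0"

primcorec plus_paracomplex where
  "PRe (x + y) = PRe x + PRe y"
| "PIm (x + y) = PIm x + PIm y"

primcorec uminus_paracomplex where
  "PRe (- x) = - PRe x"
| "PIm (- x) = - PIm x"

primcorec minus_paracomplex where
  "PRe (x - y) = PRe x - PRe y"
| "PIm (x - y) = PIm x - PIm y"

primcorec times_paracomplex where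
  "PRe (x * y) = PRe x * PRe y + PIm x * PIm y"
| "PIm (x * y) = PRe x * PIm y + PIm x * PRe y"

instance
  by standard (simp_all add: paracomplex_eq_iff algebra_simps)

end

instantiation paracomplex :: real_algebra_1
begin

primcorec scaleR_paracomplex where
  "PRe (scaleR r x) = r * PRe x"
| "PIm (scaleR r x) = r * PIm x"

instance
  by standard (simp_all add: paracomplex_eq_iff algebra_simps)

end

text \<open>The norm is the Euclidean one, so that the topology is that of the plane.
  It is not multiplicative, and not even submultiplicative.\<close>

instantiation paracomplex :: real_inner
begin

definition inner_paracomplex_def: "inner x y = PRe x * PRe y + PIm x * PIm y"

definition norm_paracomplex_def: "norm (z :: paracomplex) = sqrt ((PRe z)\<^sup>2 + (PIm z)\<^sup>2)"

definition sgn_paracomplex_def: "sgn (x :: paracomplex) = x /\<^sub>R norm x"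

definition dist_paracomplex_def: "dist x (y :: paracomplex) = norm (x - y)"

definition uniformity_paracomplex_def:
  "(uniformity :: (paracomplex \<times> paracomplex) filter) =
    (INF e\<in>{0 <..}. principal {(x, y). dist x y < e})"

definition open_paracomplex_def:
  "open (U :: paracomplex set) \<longleftrightarrow> (\<forall>x\<in>U. eventually (\<lambda>(x', y). x' = x \<longrightarrow> y \<in> U) uniformity)"

instance
proof
  fix x y z :: paracomplex and r :: real
  show "inner x y = inner y x"
    by (simp add: inner_paracomplex_def mult.commute)
  show "inner (x + y) z = inner x z + inner y z"
    by (simp add: inner_paracomplex_def algebra_simps)
  show "inner (scaleR r x) y = r * inner x y"
    by (simp add: inner_paracomplex_def algebra_simps)
  show "0 \<le> inner x x"
    by (simp add: inner_paracomplex_def)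
  show "inner x x = 0 \<longleftrightarrow> x = 0"
    by (simp add: inner_paracomplex_def add_nonneg_eq_0_iff paracomplex_eq_iff)
  show "norm x = sqrt (inner x x)"
    by (simp add: inner_paracomplex_def norm_paracomplex_def power2_eq_square)
qed (rule sgn_paracomplex_def dist_paracomplex_def open_paracomplex_def
    uniformity_paracomplex_def)+

end

definition tau :: paracomplex where
  "tau = Paracomplex 0 1"

lemma PRe_tau [simp]: "PRe tau = 0" and PIm_tau [simp]: "PIm tau = 1"
  by (simp_all add: tau_def)

lemma tau_mult_tau [simp]: "tau * tau = 1"
  by (simp add: paracomplex_eq_iff)

lemma paracomplex_decomp: "z = of_real (PRe z) + tau * of_real (PIm z)"
  by (simp add: paracomplex_eq_iff of_real_def)

instantiation paracomplex :: euclidean_space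
begin

definition Basis_paracomplex_def: "Basis = {1, tau}"

instance
proof
  have [simp]: "1 \<noteq> tau"
    by (simp add: paracomplex_eq_iff)
  show "(Basis :: paracomplex set) \<noteq> {}" and "finite (Basis :: paracomplex set)"
    by (simp_all add: Basis_paracomplex_def)
  show "inner u v = (if u = v then 1 else 0)" if "u \<in> Basis" "v \<in> Basis" for u v :: paracomplex
    using that by (auto simp: Basis_paracomplex_def inner_paracomplex_def)
  show "(\<forall>u\<in>Basis. inner x u = 0) \<longleftrightarrow> x = 0" for x :: paracomplex
    by (simp add: Basis_paracomplex_def inner_paracomplex_def paracomplex_eq_iff[of x 0])
qed

end

definition pconj :: "paracomplex \<Rightarrow> paracomplex" where
  "pconj z = Paracomplex (PRe z) (- PIm z)"


section \<open>Differentiation on open subsets of the paracomplex plane\<close>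

text \<open>Functions on a domain are total functions of which only the values on the domain matter.
  The predicate below says that \<open>f\<close> is of class \<open>C\<^sup>k\<close> on the open set \<open>S\<close>; since
  the domain is finite-dimensional, it suffices to ask this of every directional derivative.\<close>

primrec Ck_on :: "nat \<Rightarrow> 'a::euclidean_space set \<Rightarrow> ('a \<Rightarrow> 'b::real_normed_vector) \<Rightarrow> bool" where
  "Ck_on 0 S f \<longleftrightarrow> continuous_on S f"
| "Ck_on (Suc k) S f \<longleftrightarrow>
    (\<forall>x\<in>S. f differentiable (at x)) \<and> (\<forall>v. Ck_on k S (\<lambda>x. frechet_derivative f (at x) v))"

definition smooth_on :: "'a::euclidean_space set \<Rightarrow> ('a \<Rightarrow> 'b::real_normed_vector) \<Rightarrow> bool" where
  "smooth_on S f \<longleftrightarrow> (\<forall>k. Ck_on k S f)"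

text \<open>The partial derivatives with respect to \<open>u\<close> and \<open>v\<close>, where \<open>z = u + \<tau> v\<close>.\<close>

definition du :: "(paracomplex \<Rightarrow> 'b::real_normed_vector) \<Rightarrow> paracomplex \<Rightarrow> 'b" where
  "du f z = frechet_derivative f (at z) 1"

definition dv :: "(paracomplex \<Rightarrow> 'b::real_normed_vector) \<Rightarrow> paracomplex \<Rightarrow> 'b" where
  "dv f z = frechet_derivative f (at z) tau"

definition dz :: "(paracomplex \<Rightarrow> paracomplex) \<Rightarrow> paracomplex \<Rightarrow> paracomplex" where
  "dz f z = (1/2) *\<^sub>R (du f z + tau * dv f z)"

definition dzbar :: "(paracomplex \<Rightarrow> paracomplex) \<Rightarrow> paracomplex \<Rightarrow> paracomplex" where
  "dzbar f z = (1/2) *\<^sub>R (du f z - tau * dv f z)"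

definition L_differentiable_on :: "paracomplex set \<Rightarrow> (paracomplex \<Rightarrow> paracomplex) \<Rightarrow> bool" where
  "L_differentiable_on \<Omega> f \<longleftrightarrow> Ck_on 1 \<Omega> f \<and> (\<forall>z\<in>\<Omega>. dzbar f z = 0)"

definition L_harmonic_on :: "paracomplex set \<Rightarrow> (paracomplex \<Rightarrow> real) \<Rightarrow> bool" where
  "L_harmonic_on \<Omega> h \<longleftrightarrow> Ck_on 2 \<Omega> h \<and> (\<forall>z\<in>\<Omega>. du (du h) z - dv (dv h) z = 0)"


section \<open>Surfaces in Lorentz-Minkowski space\<close>

definition lor :: "real^3 \<Rightarrow> real^3 \<Rightarrow> real" where
  "lor x y = x$1 * y$1 + x$2 * y$2 - x$3 * y$3"

text \<open>The identification of \<open>\<real> \<times> \<L>\<close> with \<open>\<L>\<^sup>3\<close>.\<close>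

definition to_L3 :: "real \<times> paracomplex \<Rightarrow> real^3" where
  "to_L3 p = vector [fst p, PRe (snd p), PIm (snd p)]"

definition immersion_on :: "paracomplex set \<Rightarrow> (paracomplex \<Rightarrow> real^3) \<Rightarrow> bool" where
  "immersion_on \<Omega> \<psi> \<longleftrightarrow> smooth_on \<Omega> \<psi> \<and> (\<forall>z\<in>\<Omega>. inj (frechet_derivative \<psi> (at z)))"

definition induced_metric ::
    "(paracomplex \<Rightarrow> real^3) \<Rightarrow> paracomplex \<Rightarrow> paracomplex \<Rightarrow> paracomplex \<Rightarrow> real" where
  "induced_metric \<psi> z v w =
    lor (frechet_derivative \<psi> (at z) v) (frechet_derivative \<psi> (at z) w)"

text \<open>A Lorentzian inner product on the tangent plane: signature \<open>(1,1)\<close>.\<close>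

definition lorentzian_form :: "(paracomplex \<Rightarrow> paracomplex \<Rightarrow> real) \<Rightarrow> bool" where
  "lorentzian_form B \<longleftrightarrow> bilinear B \<and> (\<forall>v w. B v w = B w v) \<and>
    (\<exists>e1 e2. span {e1, e2} = UNIV \<and> B e1 e1 = 1 \<and> B e2 e2 = - 1 \<and> B e1 e2 = 0)"

definition timelike_on :: "paracomplex set \<Rightarrow> (paracomplex \<Rightarrow> real^3) \<Rightarrow> bool" where
  "timelike_on \<Omega> \<psi> \<longleftrightarrow> (\<forall>z\<in>\<Omega>. lorentzian_form (induced_metric \<psi> z))"

definition conformal_on :: "paracomplex set \<Rightarrow> (paracomplex \<Rightarrow> real^3) \<Rightarrow> bool" where
  "conformal_on \<Omega> \<psi> \<longleftrightarrow>
    (\<forall>z\<in>\<Omega>. lor (du \<psi> z) (du \<psi> z) = - lor (dv \<psi> z) (dv \<psi> z) \<and> lor (du \<psi> z) (dv \<psi> z) = 0)"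

definition unit_normal_field_on ::
    "paracomplex set \<Rightarrow> (paracomplex \<Rightarrow> real^3) \<Rightarrow> (paracomplex \<Rightarrow> real^3) \<Rightarrow> bool" where
  "unit_normal_field_on \<Omega> \<psi> N \<longleftrightarrow> smooth_on \<Omega> N \<and>
    (\<forall>z\<in>\<Omega>. lor (N z) (N z) = 1 \<and> (\<forall>w. lor (N z) (frechet_derivative \<psi> (at z) w) = 0))"

text \<open>The matrices of the two fundamental forms in the basis \<open>\<partial>\<^sub>u, \<partial>\<^sub>v\<close>.\<close>

definition first_ff :: "(paracomplex \<Rightarrow> real^3) \<Rightarrow> paracomplex \<Rightarrow> real^2^2" where
  "first_ff \<psi> z = vector
    [vector [lor (du \<psi> z) (du \<psi> z), lor (du \<psi> z) (dv \<psi> z)],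
     vector [lor (dv \<psi> z) (du \<psi> z), lor (dv \<psi> z) (dv \<psi> z)]]"

definition second_ff ::
    "(paracomplex \<Rightarrow> real^3) \<Rightarrow> (paracomplex \<Rightarrow> real^3) \<Rightarrow> paracomplex \<Rightarrow> real^2^2" where
  "second_ff \<psi> N z = vector
    [vector [lor (du (du \<psi>) z) (N z), lor (du (dv \<psi>) z) (N z)],
     vector [lor (dv (du \<psi>) z) (N z), lor (dv (dv \<psi>) z) (N z)]]"

definition mean_curvature ::
    "(paracomplex \<Rightarrow> real^3) \<Rightarrow> (paracomplex \<Rightarrow> real^3) \<Rightarrow> paracomplex \<Rightarrow> real" where
  "mean_curvature \<psi> N z = trace (matrix_inv (first_ff \<psi> z) ** second_ff \<psi> N z)"

text \<open>The first conjunct keeps the second one from being vacuous.\<close>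

definition minimal_on :: "paracomplex set \<Rightarrow> (paracomplex \<Rightarrow> real^3) \<Rightarrow> bool" where
  "minimal_on \<Omega> \<psi> \<longleftrightarrow> (\<exists>N. unit_normal_field_on \<Omega> \<psi> N) \<and>
    (\<forall>N. unit_normal_field_on \<Omega> \<psi> N \<longrightarrow> (\<forall>z\<in>\<Omega>. mean_curvature \<psi> N z = 0))"

definition conformal_timelike_minimal_immersion_on ::
    "paracomplex set \<Rightarrow> (paracomplex \<Rightarrow> real^3) \<Rightarrow> bool" where
  "conformal_timelike_minimal_immersion_on \<Omega> \<psi> \<longleftrightarrow>
    immersion_on \<Omega> \<psi> \<and> timelike_on \<Omega> \<psi> \<and> conformal_on \<Omega> \<psi> \<and> minimal_on \<Omega> \<psi>"

end

(*
  With E = g(psi_u, psi_u), the condition (h_z)^2 = L_z P_z says exactly that psi_v has square -E and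
  is orthogonal to psi_u; given this, the left-hand side of the second condition is the real number E,
  so that condition says E <> 0.  The harmonicity of h together with the paracomplex
  Cauchy-Riemann equations for L and P gives the wave equation psi_uu = psi_vv, and the mean
  curvature of an isothermal immersion is g(psi_uu - psi_vv, N) / E.  The Lorentzian cross product
  of psi_u and psi_v has square E^2, so dividing it by E, whatever the sign of E, gives a smooth
  unit normal field.
*)

theory Submission
  imports Defs
begin

section \<open>Functions of class \<open>C\<^sup>k\<close>\<close>

lemma has_derivative_frechet:
  "f differentiable (at x) \<Longrightarrow> (f has_derivative frechet_derivative f (at x)) (at x)"
  by (simp add: frechet_derivative_works)

lemma Ck_on_SucI:
  assumes "\<And>x. x \<in> S \<Longrightarrow> (f has_derivative D x) (at x)"
    and "\<And>v. Ck_on k S (\<lambda>x. frechet_derivative f (at x) v)"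
  shows "Ck_on (Suc k) S f"
  using assms by (auto simp: differentiable_def)

text \<open>Functions agreeing on an open set agree near each of its points, so they have the same
  derivatives there. This localises \<open>Ck_on\<close>, whose functions are total and arbitrary
  off \<open>S\<close>.\<close>

lemma Ck_on_cong:
  assumes "open S" and "\<And>x. x \<in> S \<Longrightarrow> f x = g x"
  shows "Ck_on k S f \<longleftrightarrow> Ck_on k S g"
  using assms(2)
proof (induction k arbitrary: f g)
  case 0
  then show ?case by (simp cong: continuous_on_cong)
next
  case (Suc k)
  \<comment> \<open>One direction, for arbitrary functions, so that it can be used again with
    \<open>f\<close> and \<open>g\<close> exchanged.\<close>
  have imp: "Ck_on (Suc k) S g'" if f: "Ck_on (Suc k) S f'" and eq: "\<And>x. x \<in> S \<Longrightarrow> f' x = g' x"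
    for f' g' :: "'a \<Rightarrow> 'b"
  proof (rule Ck_on_SucI)
    fix x assume "x \<in> S"
    then show "(g' has_derivative frechet_derivative f' (at x)) (at x)"
      using f eq assms(1)
      by (auto intro!: has_derivative_transform_within_open[OF has_derivative_frechet, of f' x S g'])
  next
    fix v
    have "frechet_derivative f' (at x) v = frechet_derivative g' (at x) v" if "x \<in> S" for x
      using f eq assms(1) that by (subst frechet_derivative_transform_within_open[of f' x S g']) auto
    then show "Ck_on k S (\<lambda>x. frechet_derivative g' (at x) v)"
      by (rule iffD1[OF Suc.IH]) (use f in auto)
  qed
  show ?case
    using imp[of f g] imp[of g f] Suc.prems by metis
qed

text \<open>Trades \<open>frechet_derivative\<close> for an explicit derivative \<open>D\<close>;
  the two agree on \<open>S\<close>, and \<open>Ck_on_cong\<close> does the rest. The closure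
  properties then become inductions along the differentiation rules.\<close>

lemma Ck_on_SucI':
  assumes S: "open S"
    and D: "\<And>x. x \<in> S \<Longrightarrow> (f has_derivative D x) (at x)"
    and C: "\<And>v. Ck_on k S (\<lambda>x. D x v)"
  shows "Ck_on (Suc k) S f"
proof (rule Ck_on_SucI[OF D])
  fix v
  have "frechet_derivative f (at x) v = D x v" if "x \<in> S" for x
    using frechet_derivative_at[OF D[OF that]] by simp
  then show "Ck_on k S (\<lambda>x. frechet_derivative f (at x) v)"
    by (rule iffD2[OF Ck_on_cong[OF S] C])
qed

lemma Ck_on_SucD:
  "Ck_on (Suc k) S f \<Longrightarrow> Ck_on k S f"
proof (induction k arbitrary: f)
  case 0
  then show ?case
    by (auto intro!: continuous_at_imp_continuous_on differentiable_imp_continuous_within)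
next
  case (Suc k)
  have "\<And>v. Ck_on (Suc k) S (\<lambda>x. frechet_derivative f (at x) v)" and "\<forall>x\<in>S. f differentiable (at x)"
    using Suc.prems by auto
  with Suc.IH show ?case
    unfolding Ck_on.simps(2)[of k S f] by blast
qed

section \<open>Closure of \<open>Ck_on\<close> and \<open>smooth_on\<close> under algebraic
  operations\<close>

lemma Ck_on_add:
  assumes "open S" "Ck_on k S f" "Ck_on k S g"
  shows "Ck_on k S (\<lambda>x. f x + g x)"
  using assms(2,3)
proof (induction k arbitrary: f g)
  case 0
  then show ?case by (simp add: continuous_on_add)
next
  case (Suc k)
  show ?case
    by (rule Ck_on_SucI'[OF assms(1)], rule has_derivative_add) (use Suc in \<open>auto intro: has_derivative_frechet\<close>)
qed

lemma Ck_on_bounded_linear: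
  assumes "bounded_linear T" "open S" "Ck_on k S f"
  shows "Ck_on k S (\<lambda>x. T (f x))"
  using assms(3)
proof (induction k arbitrary: f)
  case 0
  then show ?case by (simp add: bounded_linear.continuous_on[OF assms(1)])
next
  case (Suc k)
  show ?case
    by (rule Ck_on_SucI'[OF assms(2)], rule bounded_linear.has_derivative[OF assms(1)])
      (use Suc in \<open>auto intro: has_derivative_frechet\<close>)
qed

lemma Ck_on_bounded_bilinear:
  assumes "bounded_bilinear B" "open S" "Ck_on k S f" "Ck_on k S g"
  shows "Ck_on k S (\<lambda>x. B (f x) (g x))"
  using assms(3,4)
proof (induction k arbitrary: f g)
  case 0
  then show ?case by (simp add: bounded_bilinear.continuous_on[OF assms(1)])
next
  case (Suc k)
  \<comment> \<open>The product rule leaves one factor undifferentiated, so \<open>f\<close> and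
    \<open>g\<close> themselves are needed at level \<open>k\<close>.\<close>
  note prev = Ck_on_SucD[OF Suc.prems(1)] Ck_on_SucD[OF Suc.prems(2)]
  show ?case
    by (rule Ck_on_SucI'[OF assms(2)], rule bounded_bilinear.FDERIV[OF assms(1)])
      (use Suc prev in \<open>auto intro: has_derivative_frechet Ck_on_add[OF assms(2)]\<close>)
qed

text \<open>The derivative of \<open>1/f\<close> is a product of \<open>1/f\<close>,
  \<open>f'\<close> and \<open>1/f\<close>, so the induction hypothesis for \<open>1/f\<close>
  itself yields one more order.\<close>

lemma Ck_on_inverse:
  fixes f :: "'a::euclidean_space \<Rightarrow> 'b::real_normed_field"
  assumes "open S" "Ck_on k S f" "\<And>x. x \<in> S \<Longrightarrow> f x \<noteq> 0"
  shows "Ck_on k S (\<lambda>x. inverse (f x))"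
  using assms(2)
proof (induction k)
  case 0
  then show ?case using assms(3) by (simp add: continuous_on_inverse)
next
  case (Suc k)
  note inv = Suc.IH[OF Ck_on_SucD[OF Suc.prems]]
  note mult = Ck_on_bounded_bilinear[OF bounded_bilinear_mult assms(1)]
  note neg = Ck_on_bounded_linear[OF bounded_linear_minus[OF bounded_linear_ident] assms(1)]
  show ?case
  proof (rule Ck_on_SucI'[OF assms(1)])
    fix x assume "x \<in> S"
    then show "((\<lambda>x. inverse (f x)) has_derivative
        (\<lambda>v. - (inverse (f x) * frechet_derivative f (at x) v * inverse (f x)))) (at x)"
      using Suc.prems assms(3) by (intro Deriv.has_derivative_inverse) (auto intro: has_derivative_frechet)
  next
    fix v
    show "Ck_on k S (\<lambda>x. - (inverse (f x) * frechet_derivative f (at x) v * inverse (f x)))"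
      by (rule neg[OF mult[OF mult[OF inv] inv]]) (use Suc.prems in simp)
  qed
qed

lemma smooth_on_add:
  "open S \<Longrightarrow> smooth_on S f \<Longrightarrow> smooth_on S g \<Longrightarrow> smooth_on S (\<lambda>x. f x + g x)"
  by (simp add: smooth_on_def Ck_on_add)

lemma smooth_on_bounded_linear:
  "bounded_linear T \<Longrightarrow> open S \<Longrightarrow> smooth_on S f \<Longrightarrow> smooth_on S (\<lambda>x. T (f x))"
  by (simp add: smooth_on_def Ck_on_bounded_linear)

lemma smooth_on_bounded_bilinear:
  "bounded_bilinear B \<Longrightarrow> open S \<Longrightarrow> smooth_on S f \<Longrightarrow> smooth_on S g \<Longrightarrow>
    smooth_on S (\<lambda>x. B (f x) (g x))"
  by (simp add: smooth_on_def Ck_on_bounded_bilinear)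

lemma smooth_on_inverse:
  fixes f :: "'a::euclidean_space \<Rightarrow> 'b::real_normed_field"
  shows "open S \<Longrightarrow> smooth_on S f \<Longrightarrow> (\<And>x. x \<in> S \<Longrightarrow> f x \<noteq> 0) \<Longrightarrow> smooth_on S (\<lambda>x. inverse (f x))"
  by (simp add: smooth_on_def Ck_on_inverse)

lemma smooth_on_frechet_derivative:
  "smooth_on S f \<Longrightarrow> smooth_on S (\<lambda>x. frechet_derivative f (at x) v)"
  unfolding smooth_on_def by (metis Ck_on.simps(2))

lemma smooth_on_has_derivative:
  "smooth_on S f \<Longrightarrow> x \<in> S \<Longrightarrow> (f has_derivative frechet_derivative f (at x)) (at x)"
  unfolding smooth_on_def by (metis Ck_on.simps(2) has_derivative_frechet)


section \<open>Symmetry of the second derivative\<close>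

text \<open>The one-variable mean value theorem along the segment from \<open>y\<close> to
  \<open>y + t v\<close>.\<close>

lemma MVT_line:
  fixes f :: "'a::real_normed_vector \<Rightarrow> real"
  assumes "0 < t" and f: "\<And>s. 0 \<le> s \<Longrightarrow> s \<le> t \<Longrightarrow> (f has_derivative f' (y + s *\<^sub>R v)) (at (y + s *\<^sub>R v))"
  shows "\<exists>s. 0 < s \<and> s < t \<and> f (y + t *\<^sub>R v) - f y = t * f' (y + s *\<^sub>R v) v"
proof -
  have "((\<lambda>s. f (y + s *\<^sub>R v)) has_real_derivative f' (y + s *\<^sub>R v) v) (at s)"
    if "0 \<le> s" "s \<le> t" for s
  proof -
    have "((\<lambda>s. f (y + s *\<^sub>R v)) has_derivative (\<lambda>r. f' (y + s *\<^sub>R v) (r *\<^sub>R v))) (at s)"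
      by (rule has_derivative_compose[of "\<lambda>s. y + s *\<^sub>R v", OF _ f[OF that]])
        (auto intro!: derivative_eq_intros)
    moreover have "(\<lambda>r. f' (y + s *\<^sub>R v) (r *\<^sub>R v)) = (*) (f' (y + s *\<^sub>R v) v)"
      using linear_cmul[OF has_derivative_linear[OF f[OF that]]] by (auto simp: mult.commute)
    ultimately show ?thesis by (simp add: has_field_derivative_def)
  qed
  from MVT2[OF \<open>0 < t\<close> this] show ?thesis by auto
qed

text \<open>The second difference is the increment in direction \<open>v\<close> of the first
  difference in direction \<open>w\<close>; one mean value theorem in each direction turns it into a
  mixed derivative.\<close>

lemma second_difference_MVT:
  fixes f :: "'a::euclidean_space \<Rightarrow> real"
  assumes f: "Ck_on 2 S f" and r: "ball x r \<subseteq> S"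
    and t: "0 < t" "t * (norm v + norm w) < r"
  shows "\<exists>p\<in>ball x r. f (x + t *\<^sub>R v + t *\<^sub>R w) - f (x + t *\<^sub>R v) - f (x + t *\<^sub>R w) + f x =
    t * t * frechet_derivative (\<lambda>y. frechet_derivative f (at y) v) (at p) w"
proof -
  let ?Df = "\<lambda>y. frechet_derivative f (at y)"
  \<comment> \<open>The whole parallelogram spanned by \<open>t v\<close> and \<open>t w\<close> at
    \<open>x\<close> lies in the ball.\<close>
  have inS: "x + a *\<^sub>R v + b *\<^sub>R w \<in> ball x r" if "0 \<le> a" "a \<le> t" "0 \<le> b" "b \<le> t" for a b
  proof -
    have "norm (a *\<^sub>R v + b *\<^sub>R w) \<le> a * norm v + b * norm w"
      using that by (metis norm_triangle_ineq norm_scaleR abs_of_nonneg)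
    also have "\<dots> \<le> t * (norm v + norm w)"
      using that by (simp add: distrib_left add_mono mult_right_mono)
    finally have "norm (a *\<^sub>R v + b *\<^sub>R w) < r"
      using t by simp
    then show ?thesis
      using norm_minus_cancel[of "a *\<^sub>R v + b *\<^sub>R w"] by (simp add: dist_norm algebra_simps)
  qed
  have D1: "(f has_derivative ?Df y) (at y)" if "y \<in> ball x r" for y
    by (rule has_derivative_frechet) (use f r that in \<open>auto simp: numeral_2_eq_2\<close>)
  have D2: "((\<lambda>y. ?Df y v) has_derivative frechet_derivative (\<lambda>y. ?Df y v) (at y)) (at y)"
    if "y \<in> ball x r" for y
    by (rule has_derivative_frechet) (use f r that in \<open>auto simp: numeral_2_eq_2\<close>)
  let ?F = "\<lambda>y. f (y + t *\<^sub>R w) - f y"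
  have "(?F has_derivative (\<lambda>k. ?Df (x + s *\<^sub>R v + t *\<^sub>R w) k - ?Df (x + s *\<^sub>R v) k)) (at (x + s *\<^sub>R v))"
    if "0 \<le> s" "s \<le> t" for s
  proof (rule has_derivative_diff)
    show "((\<lambda>y. f (y + t *\<^sub>R w)) has_derivative ?Df (x + s *\<^sub>R v + t *\<^sub>R w)) (at (x + s *\<^sub>R v))"
      by (rule has_derivative_compose[of "\<lambda>y. y + t *\<^sub>R w" "\<lambda>k. k", OF _ D1[OF inS]])
        (use that t in \<open>auto intro!: derivative_eq_intros\<close>)
    show "(f has_derivative ?Df (x + s *\<^sub>R v)) (at (x + s *\<^sub>R v))"
      using D1[OF inS[of s 0]] that t by simp
  qed
  from MVT_line[of t ?F "\<lambda>y k. ?Df (y + t *\<^sub>R w) k - ?Df y k", OF t(1) this]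
  obtain s where s: "0 < s" "s < t"
    and 1: "?F (x + t *\<^sub>R v) - ?F x = t * (?Df (x + s *\<^sub>R v + t *\<^sub>R w) v - ?Df (x + s *\<^sub>R v) v)"
    by auto
  from MVT_line[of t "\<lambda>y. ?Df y v" "\<lambda>y. frechet_derivative (\<lambda>y. ?Df y v) (at y)" "x + s *\<^sub>R v" w,
      OF t(1) D2[OF inS]] s
  obtain q where q: "0 < q" "q < t"
    and 2: "?Df (x + s *\<^sub>R v + t *\<^sub>R w) v - ?Df (x + s *\<^sub>R v) v =
      t * frechet_derivative (\<lambda>y. ?Df y v) (at (x + s *\<^sub>R v + q *\<^sub>R w)) w"
    by auto
  show ?thesis
    using 1 2 inS[of s q] s q by (intro bexI[of _ "x + s *\<^sub>R v + q *\<^sub>R w"]) (auto simp: algebra_simps)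
qed

text \<open>The second difference is symmetric in \<open>v\<close> and \<open>w\<close>, so the two
  mixed derivatives take equal values at two points arbitrarily close to \<open>x\<close>;
  continuity carries the equality to \<open>x\<close>.\<close>

lemma symmetric_second_derivative_real:
  fixes f :: "'a::euclidean_space \<Rightarrow> real"
  assumes S: "open S" "x \<in> S" and f: "Ck_on 2 S f"
  shows "frechet_derivative (\<lambda>y. frechet_derivative f (at y) v) (at x) w =
    frechet_derivative (\<lambda>y. frechet_derivative f (at y) w) (at x) v"
proof -
  define A where "A v w y = frechet_derivative (\<lambda>y. frechet_derivative f (at y) v) (at y) w" for v w y
  have "isCont (A v w) x" for v w
    using f S by (auto simp: A_def[abs_def] numeral_2_eq_2 continuous_on_eq_continuous_at)
  then have cont: "\<exists>d>0. \<forall>y. dist x y < d \<longrightarrow> dist (A v w x) (A v w y) < e" if "e > 0" for v w e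
    using that by (metis continuous_at_eps_delta dist_commute)
  have "dist (A v w x) (A w v x) \<le> 2 * e" if "e > 0" for e
  proof -
    obtain d1 where d1: "d1 > 0" "\<And>y. dist x y < d1 \<Longrightarrow> dist (A v w x) (A v w y) < e"
      using cont[OF \<open>e > 0\<close>] by blast
    obtain d2 where d2: "d2 > 0" "\<And>y. dist x y < d2 \<Longrightarrow> dist (A w v x) (A w v y) < e"
      using cont[OF \<open>e > 0\<close>] by blast
    obtain d3 where d3: "d3 > 0" "ball x d3 \<subseteq> S"
      using S by (meson open_contains_ball)
    define r where "r = min d1 (min d2 d3)"
    have r: "r > 0" "r \<le> d1" "r \<le> d2" "ball x r \<subseteq> S"
      using d1 d2 d3 by (auto simp: r_def)
    \<comment> \<open>The summand 1 keeps the denominator positive when \<open>v\<close> and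
      \<open>w\<close> vanish, and makes the bound by \<open>r\<close> strict.\<close>
    define t where "t = r / (norm v + norm w + 1)"
    have "norm v + norm w + 1 > 0" by (simp add: add_nonneg_pos)
    then have t: "t > 0" "t * (norm v + norm w) < r"
      using r(1) by (simp_all add: t_def field_simps)
    obtain p where p: "p \<in> ball x r"
      "f (x + t *\<^sub>R v + t *\<^sub>R w) - f (x + t *\<^sub>R v) - f (x + t *\<^sub>R w) + f x = t * t * A v w p"
      using second_difference_MVT[OF f r(4) t] by (auto simp: A_def)
    have "t * (norm w + norm v) < r" using t by (simp add: add.commute)
    from second_difference_MVT[OF f r(4) t(1) this] obtain q where q: "q \<in> ball x r"
      "f (x + t *\<^sub>R w + t *\<^sub>R v) - f (x + t *\<^sub>R w) - f (x + t *\<^sub>R v) + f x = t * t * A w v q"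
      by (auto simp: A_def)
    have swap: "x + t *\<^sub>R w + t *\<^sub>R v = x + t *\<^sub>R v + t *\<^sub>R w" by simp
    have "t * t * A v w p = t * t * A w v q"
      using p(2) q(2)[unfolded swap] by linarith
    then have "A v w p = A w v q" using t by simp
    moreover have "dist (A v w x) (A v w p) < e" "dist (A w v x) (A w v q) < e"
      using p q r d1 d2 by auto
    ultimately show ?thesis
      by (auto simp: dist_real_def)
  qed
  then have "dist (A v w x) (A w v x) \<le> 0 + e" if "e > 0" for e
    using that by (metis add_0 field_sum_of_halves half_gt_zero mult_2)
  then have "dist (A v w x) (A w v x) \<le> 0"
    by (rule field_le_epsilon)
  then show ?thesis by (simp add: A_def)
qed

section \<open>From real-valued to vector-valued functions\<close>

lemma frechet_derivative_bounded_linear: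
  assumes "bounded_linear T" "f differentiable (at x)"
  shows "frechet_derivative (\<lambda>x. T (f x)) (at x) = (\<lambda>v. T (frechet_derivative f (at x) v))"
  by (rule frechet_derivative_at[symmetric], rule bounded_linear.has_derivative[OF assms(1)])
    (rule has_derivative_frechet[OF assms(2)])

text \<open>\<open>T\<close> commutes with the first derivative on all of the open set
  \<open>S\<close>, so that identity can be differentiated once more at \<open>x\<close>.\<close>

lemma second_derivative_bounded_linear:
  assumes T: "bounded_linear T" and S: "open S" "x \<in> S" and f: "Ck_on 2 S f"
  shows "frechet_derivative (\<lambda>y. frechet_derivative (\<lambda>y. T (f y)) (at y) v) (at x) w =
    T (frechet_derivative (\<lambda>y. frechet_derivative f (at y) v) (at x) w)"
proof -
  have d1: "f differentiable (at y)" if "y \<in> S" for y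
    using f that by (simp add: numeral_2_eq_2)
  have d2: "(\<lambda>y. frechet_derivative f (at y) v) differentiable (at x)"
    using f S by (simp add: numeral_2_eq_2)
  have "frechet_derivative (\<lambda>y. frechet_derivative (\<lambda>y. T (f y)) (at y) v) (at x) =
      frechet_derivative (\<lambda>y. T (frechet_derivative f (at y) v)) (at x)"
    by (rule frechet_derivative_transform_within_open[symmetric, where X = S])
      (use S d1 d2 in \<open>auto simp: frechet_derivative_bounded_linear[OF T]
        intro: differentiableI bounded_linear.has_derivative[OF T has_derivative_frechet]\<close>)
  then show ?thesis
    by (simp add: frechet_derivative_bounded_linear[OF T d2])
qed

text \<open>Pairing with every vector \<open>c\<close> reduces to the real-valued case.\<close>

lemma symmetric_second_derivative:
  fixes f :: "'a::euclidean_space \<Rightarrow> 'b::real_inner"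
  assumes S: "open S" "x \<in> S" and f: "Ck_on 2 S f"
  shows "frechet_derivative (\<lambda>y. frechet_derivative f (at y) v) (at x) w =
    frechet_derivative (\<lambda>y. frechet_derivative f (at y) w) (at x) v" (is "?l = ?r")
proof -
  have "c \<bullet> ?l = c \<bullet> ?r" for c
    using symmetric_second_derivative_real[OF S Ck_on_bounded_linear[OF _ S(1) f], of "(\<bullet>) c" v w]
    by (simp add: second_derivative_bounded_linear[OF bounded_linear_inner_right S f] bounded_linear_inner_right)
  then show ?thesis
    by (metis vector_eq_ldot)
qed

text \<open>The Cauchy-Riemann equation reads \<open>f_u = tau f_v\<close>. Differentiating it in
  both variables and exchanging the mixed derivatives gives \<open>f_uu = tau^2 f_vv\<close>, and
  \<open>tau^2 = 1\<close>.\<close>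

lemma du_du_eq_dv_dv:
  assumes "open S" "z \<in> S" and f: "Ck_on 2 S f" and L: "L_differentiable_on S f"
  shows "du (du f) z = dv (dv f) z"
proof -
  have CR: "du f w = tau * dv f w" if "w \<in> S" for w
    using L that by (auto simp: L_differentiable_on_def dzbar_def)
  \<comment> \<open>The Euclidean norm is not submultiplicative, so boundedness comes from linearity
    in finite dimension.\<close>
  have T: "bounded_linear ((*) tau)"
    by (simp add: linear_conv_bounded_linear[symmetric] linear_iff algebra_simps)
  have diff: "(\<lambda>w. frechet_derivative f (at w) v) differentiable (at z)" for v
    using f assms(2) by (simp add: numeral_2_eq_2)
  have "frechet_derivative (du f) (at z) = frechet_derivative (\<lambda>w. tau * dv f w) (at z)"
    using diff[of 1] assms(1,2) CR
    by (intro frechet_derivative_transform_within_open[where X = S]) (auto simp: du_def[abs_def])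
  then have D: "frechet_derivative (du f) (at z) w = tau * frechet_derivative (dv f) (at z) w" for w
    using diff[of tau] by (simp add: frechet_derivative_bounded_linear[OF T] dv_def[abs_def])
  have "du (du f) z = tau * frechet_derivative (dv f) (at z) 1"
    by (simp only: du_def[of "du f"] D)
  also have "frechet_derivative (dv f) (at z) 1 = frechet_derivative (du f) (at z) tau"
    unfolding du_def[abs_def] dv_def[abs_def]
    by (rule symmetric_second_derivative[OF assms(1,2) f])
  also have "tau * \<dots> = (tau * tau) * dv (dv f) z"
    by (simp only: D dv_def[of "dv f"] mult.assoc)
  finally show ?thesis by simp
qed


section \<open>Lorentzian linear algebra\<close>

lemma bilinear_lor: "bilinear lor"
  by (simp add: bilinear_def linear_iff lor_def algebra_simps)

lemma lor_commute: "lor x y = lor y x"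
  by (simp add: lor_def algebra_simps)

text \<open>The Euclidean cross product with its third component negated, so that
  \<open>lor (lor_cross x y) w\<close> is the determinant of \<open>x\<close>, \<open>y\<close>,
  \<open>w\<close>.\<close>

definition lor_cross :: "real^3 \<Rightarrow> real^3 \<Rightarrow> real^3" where
  "lor_cross x y = vector [x$2 * y$3 - x$3 * y$2, x$3 * y$1 - x$1 * y$3, x$2 * y$1 - x$1 * y$2]"

lemma bilinear_lor_cross: "bilinear lor_cross"
  by (simp add: bilinear_def linear_iff lor_cross_def vec_eq_iff forall_3 algebra_simps)

lemma lor_lor_cross_self: "lor (lor_cross x y) x = 0" "lor (lor_cross x y) y = 0"
  by (simp_all add: lor_def lor_cross_def algebra_simps)

text \<open>Lagrange's identity, with the sign opposite to the Euclidean one; on an isothermal frame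
  the value is \<open>E^2\<close>, so the normal is spacelike.\<close>

lemma lor_lor_cross: "lor (lor_cross x y) (lor_cross x y) = (lor x y)\<^sup>2 - lor x x * lor y y"
  by (simp add: lor_def lor_cross_def power2_eq_square algebra_simps)

lemma span_1_tau: "span {1, tau} = UNIV"
  using span_Basis[where 'a = paracomplex] by (simp add: Basis_paracomplex_def)

section \<open>Linear maps sending \<open>1\<close> and \<open>tau\<close> to an isothermal frame,
  modelling the differential at a point\<close>

context
  fixes D :: "paracomplex \<Rightarrow> real^3" and E :: real
  assumes linear: "linear D"
    and isothermal: "lor (D 1) (D 1) = E" "lor (D tau) (D tau) = - E" "lor (D 1) (D tau) = 0"
    and nondegenerate: "E \<noteq> 0"
begin

lemma isothermal_decomp: "D w = PRe w *\<^sub>R D 1 + PIm w *\<^sub>R D tau"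
proof -
  have "w = PRe w *\<^sub>R 1 + PIm w *\<^sub>R tau"
    by (simp add: paracomplex_eq_iff)
  then show ?thesis
    by (metis linear linear_add linear_cmul)
qed

lemma isothermal_lor: "lor (D v) (D w) = E * (PRe v * PRe w - PIm v * PIm w)"
  using isothermal lor_commute[of "D tau" "D 1"]
  by (simp add: isothermal_decomp[of v] isothermal_decomp[of w] bilinear_ladd[OF bilinear_lor] bilinear_radd[OF bilinear_lor]
      bilinear_lmul[OF bilinear_lor] bilinear_rmul[OF bilinear_lor] algebra_simps)

text \<open>A vector in the kernel is orthogonal to everything for the pulled-back form, which is
  nondegenerate since \<open>E \<noteq> 0\<close>.\<close>

lemma isothermal_inj: "inj D"
proof (rule linear_injective_0[OF linear, THEN iffD2], intro allI impI)
  fix w assume "D w = 0"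
  then have "lor (D w) (D v) = 0" for v
    by (simp add: bilinear_lzero[OF bilinear_lor])
  then have "PRe w * PRe v - PIm w * PIm v = 0" for v
    using nondegenerate by (simp add: isothermal_lor)
  from this[of 1] this[of tau] show "w = 0"
    by (simp add: paracomplex_eq_iff)
qed

lemma isothermal_lorentzian_form: "lorentzian_form (\<lambda>v w. lor (D v) (D w))"
  unfolding lorentzian_form_def
proof (intro conjI allI)
  show "bilinear (\<lambda>v w. lor (D v) (D w))"
    by (simp add: bilinear_def linear_iff isothermal_lor algebra_simps)
  show "lor (D v) (D w) = lor (D w) (D v)" for v w
    by (rule lor_commute)
  \<comment> \<open>Scaling by \<open>c\<close> normalises the squares \<open>E\<close> and
    \<open>- E\<close> of the frame to 1 and -1, up to order.\<close>
  define c where "c = 1 / sqrt \<bar>E\<bar>"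
  have c: "c \<noteq> 0" "c * c * \<bar>E\<bar> = 1"
    using nondegenerate by (simp_all add: c_def)
  have "span {c *\<^sub>R 1, c *\<^sub>R tau} = UNIV"
    using span_image_scale[of "{1, tau}" "\<lambda>_. c"] c by (simp add: span_1_tau)
  then show "\<exists>e1 e2. span {e1, e2} = UNIV \<and> lor (D e1) (D e1) = 1 \<and>
      lor (D e2) (D e2) = - 1 \<and> lor (D e1) (D e2) = 0"
  proof (cases "E > 0")
    case True
    then show ?thesis using c \<open>span _ = UNIV\<close>
      by (intro exI[of _ "c *\<^sub>R 1"] exI[of _ "c *\<^sub>R tau"]) (simp add: isothermal_lor algebra_simps)
  next
    \<comment> \<open>For negative \<open>E\<close> the direction \<open>tau\<close> is the
      spacelike one, so the two vectors change places.\<close>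
    case False
    then show ?thesis using c \<open>span _ = UNIV\<close>
      by (intro exI[of _ "c *\<^sub>R tau"] exI[of _ "c *\<^sub>R 1"]) (simp add: isothermal_lor insert_commute algebra_simps)
  qed
qed

end


section \<open>Isothermal immersions\<close>

text \<open>The inverse of \<open>diag(E, -E)\<close> is \<open>diag(1/E, -1/E)\<close>, which makes
  the mean curvature a multiple of the normal part of the wave operator.\<close>

lemma trace_matrix_inv_isothermal:
  fixes B :: "real^2^2"
  assumes "E \<noteq> 0"
  shows "trace (matrix_inv (vector [vector [E, 0], vector [0, - E]]) ** B) = (B$1$1 - B$2$2) / E"
proof -
  define A :: "real^2^2" where "A = vector [vector [E, 0], vector [0, - E]]"
  define A' :: "real^2^2" where "A' = vector [vector [1/E, 0], vector [0, - 1/E]]"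
  have A': "A ** A' = mat 1" "A' ** A = mat 1"
    using assms by (simp_all add: A_def A'_def matrix_matrix_mult_def mat_def vec_eq_iff forall_2 sum_2)
  \<comment> \<open>\<open>matrix_inv\<close> is a choice among two-sided inverses;
    \<open>A'\<close> shows that one exists, and uniqueness then identifies the two.\<close>
  then have "A ** matrix_inv A = mat 1 \<and> matrix_inv A ** A = mat 1"
    unfolding matrix_inv_def by (intro someI[of "\<lambda>X. A ** X = mat 1 \<and> X ** A = mat 1"]) simp
  then have "matrix_inv A = A'"
    by (metis A'(1) matrix_mul_assoc matrix_mul_lid matrix_mul_rid)
  then show ?thesis
    by (simp add: A_def[symmetric]) (simp add: A'_def trace_def matrix_matrix_mult_def sum_2 diff_divide_distrib)
qed

text \<open>Separates the geometry from the representation formula: what remains for a concrete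
  \<open>\<psi>\<close> is isothermality, \<open>E \<noteq> 0\<close> and the wave equation.\<close>

lemma isothermal_minimal:
  assumes S: "open S" and smooth: "smooth_on S \<psi>"
    and conf: "conformal_on S \<psi>" and nondeg: "\<And>z. z \<in> S \<Longrightarrow> lor (du \<psi> z) (du \<psi> z) \<noteq> 0"
    and wave: "\<And>z. z \<in> S \<Longrightarrow> du (du \<psi>) z = dv (dv \<psi>) z"
  shows "conformal_timelike_minimal_immersion_on S \<psi>"
proof -
  define E where "E z = lor (du \<psi> z) (du \<psi> z)" for z
  have E: "E z \<noteq> 0" "lor (du \<psi> z) (du \<psi> z) = E z" "lor (dv \<psi> z) (dv \<psi> z) = - E z"
    "lor (du \<psi> z) (dv \<psi> z) = 0" if "z \<in> S" for z
    using conf nondeg that by (auto simp: E_def conformal_on_def)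
  have lin: "linear (frechet_derivative \<psi> (at z))" if "z \<in> S" for z
    using smooth_on_has_derivative[OF smooth that] by (rule has_derivative_linear)
  note D = isothermal_inj isothermal_lorentzian_form isothermal_decomp
  note D = D[OF lin E(2-4,1)[unfolded du_def dv_def]]
  define N where "N z = inverse (E z) *\<^sub>R lor_cross (du \<psi> z) (dv \<psi> z)" for z
  have "smooth_on S (du \<psi>)" "smooth_on S (dv \<psi>)"
    unfolding du_def[abs_def] dv_def[abs_def] by (intro smooth_on_frechet_derivative smooth)+
  then have "smooth_on S N"
    unfolding N_def[abs_def] using E(1) S
    by (intro smooth_on_bounded_bilinear[OF bounded_bilinear_scaleR] smooth_on_inverse
        smooth_on_bounded_bilinear[OF bilinear_lor_cross[unfolded bilinear_conv_bounded_bilinear]])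
      (auto simp: E_def[abs_def] intro: smooth_on_bounded_bilinear[OF bilinear_lor[unfolded bilinear_conv_bounded_bilinear]])
  moreover have "lor (N z) (N z) = 1" if "z \<in> S" for z
    using E[OF that] by (simp add: N_def bilinear_lmul[OF bilinear_lor] bilinear_rmul[OF bilinear_lor] lor_lor_cross
        power2_eq_square field_simps)
  \<comment> \<open>Every tangent vector is a combination of \<open>du \<psi> z\<close> and
    \<open>dv \<psi> z\<close>, both orthogonal to their cross product. Each repeated
    \<open>that\<close> discharges the membership premise of one of the five instantiated
    hypotheses.\<close>
  moreover have "lor (N z) (frechet_derivative \<psi> (at z) w) = 0" if "z \<in> S" for z w
    by (subst D(3)[OF that that that that that])
      (simp add: N_def du_def dv_def lor_lor_cross_self bilinear_radd[OF bilinear_lor]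
        bilinear_lmul[OF bilinear_lor] bilinear_rmul[OF bilinear_lor])
  ultimately have "unit_normal_field_on S \<psi> N"
    by (simp add: unit_normal_field_on_def)
  \<comment> \<open>By the wave equation the two diagonal entries of \<open>second_ff\<close> agree,
    so their difference over \<open>E\<close> vanishes.\<close>
  moreover have "mean_curvature \<psi> N' z = 0" if "z \<in> S" for N' z
    using E[OF that] wave[OF that] lor_commute[of "dv \<psi> z" "du \<psi> z"]
    by (simp add: mean_curvature_def first_ff_def second_ff_def trace_matrix_inv_isothermal)
  ultimately have "minimal_on S \<psi>"
    by (auto simp: minimal_on_def)
  moreover have "immersion_on S \<psi>" "timelike_on S \<psi>"
    using smooth D(1,2) by (auto simp: immersion_on_def timelike_on_def induced_metric_def[abs_def])
  ultimately show ?thesis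
    using conf by (simp add: conformal_timelike_minimal_immersion_on_def)
qed

section \<open>The surface built from \<open>h\<close>, \<open>L\<close> and
  \<open>P\<close>\<close>

theorem theorem5p1:
  fixes \<Omega> :: "paracomplex set"
    and h :: "paracomplex \<Rightarrow> real"
    and L P :: "paracomplex \<Rightarrow> paracomplex"
  assumes "open \<Omega>" and "connected \<Omega>" and "\<Omega> \<noteq> {}" and "simply_connected \<Omega>"
    and "smooth_on \<Omega> h" and "L_harmonic_on \<Omega> h"
    and "smooth_on \<Omega> L" and "L_differentiable_on \<Omega> L"
    and "smooth_on \<Omega> P" and "L_differentiable_on \<Omega> P"
    and "\<And>z. z \<in> \<Omega> \<Longrightarrow> (dz (\<lambda>w. of_real (h w)) z)\<^sup>2 = dz L z * dz P z"
    and "\<And>z. z \<in> \<Omega> \<Longrightarrow>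
      2 * dz (\<lambda>w. of_real (h w)) z * pconj (dz (\<lambda>w. of_real (h w)) z)
        + dz L z * pconj (dz L z) + dz P z * pconj (dz P z) \<noteq> 0"
  shows "conformal_timelike_minimal_immersion_on \<Omega> (\<lambda>z. to_L3 (h z, L z - pconj (P z)))"
proof -
  note S = \<open>open \<Omega>\<close>
  \<comment> \<open>Conjugation is only real-linear, so \<open>\<psi>\<close> is split into
    real-linear images of \<open>h\<close>, \<open>L\<close> and \<open>P\<close>; \<open>T3\<close>
    absorbs both the conjugation and the minus sign.\<close>
  define T1 where "T1 r = to_L3 (r, 0)" for r
  define T2 where "T2 w = to_L3 (0, w)" for w
  define T3 where "T3 w = to_L3 (0, - pconj w)" for w
  note T_defs = T1_def T2_def T3_def to_L3_def pconj_def
  define \<psi> where "\<psi> z = to_L3 (h z, L z - pconj (P z))" for z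
  have T: "bounded_linear T1" "bounded_linear T2" "bounded_linear T3"
    by (simp_all add: linear_conv_bounded_linear[symmetric] linear_iff T_defs vec_eq_iff forall_3)
  have \<psi>: "\<psi> = (\<lambda>z. T1 (h z) + T2 (L z) + T3 (P z))"
    by (simp add: fun_eq_iff \<psi>_def T_defs vec_eq_iff forall_3)
  \<comment> \<open>Stated for general functions so as to apply to \<open>h\<close>,
    \<open>L\<close>, \<open>P\<close> and again to their first derivatives.\<close>
  have deriv: "((\<lambda>z. T1 (f z) + T2 (g z) + T3 (k z)) has_derivative
      (\<lambda>v. T1 (frechet_derivative f (at z) v) + T2 (frechet_derivative g (at z) v) +
        T3 (frechet_derivative k (at z) v))) (at z)"
    if "z \<in> \<Omega>" "smooth_on \<Omega> f" "smooth_on \<Omega> g" "smooth_on \<Omega> k" for f g k z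
    using that by (intro has_derivative_add T[THEN bounded_linear.has_derivative] smooth_on_has_derivative)
  have smooth: "smooth_on \<Omega> \<psi>"
    unfolding \<psi> using S assms by (intro smooth_on_add T[THEN smooth_on_bounded_linear])
  have D\<psi>: "frechet_derivative \<psi> (at z) v = T1 (frechet_derivative h (at z) v) +
      T2 (frechet_derivative L (at z) v) + T3 (frechet_derivative P (at z) v)" if "z \<in> \<Omega>" for z v
    using fun_cong[OF frechet_derivative_at[OF deriv[OF that]], of h L P v] assms by (simp add: \<psi>)
  have DD\<psi>: "frechet_derivative (\<lambda>z. frechet_derivative \<psi> (at z) v) (at z) v =
      T1 (frechet_derivative (\<lambda>z. frechet_derivative h (at z) v) (at z) v) +
      T2 (frechet_derivative (\<lambda>z. frechet_derivative L (at z) v) (at z) v) +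
      T3 (frechet_derivative (\<lambda>z. frechet_derivative P (at z) v) (at z) v)" if "z \<in> \<Omega>" for z v
  proof -
    let ?D = "\<lambda>f z. frechet_derivative f (at z) v"
    have d: "((\<lambda>z. T1 (?D h z) + T2 (?D L z) + T3 (?D P z)) has_derivative
      (\<lambda>v. T1 (frechet_derivative (?D h) (at z) v) + T2 (frechet_derivative (?D L) (at z) v) +
        T3 (frechet_derivative (?D P) (at z) v))) (at z)"
      using that assms by (intro deriv smooth_on_frechet_derivative)
    have "(?D \<psi> has_derivative
      (\<lambda>v. T1 (frechet_derivative (?D h) (at z) v) + T2 (frechet_derivative (?D L) (at z) v) +
        T3 (frechet_derivative (?D P) (at z) v))) (at z)"
      by (rule has_derivative_transform_within_open[OF d S that]) (simp add: D\<psi>)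
    then show ?thesis by (simp add: frechet_derivative_at[symmetric])
  qed
  have Ck2: "Ck_on 2 \<Omega> L" "Ck_on 2 \<Omega> P"
    using assms by (auto simp: smooth_on_def)
  have wave: "du (du \<psi>) z = dv (dv \<psi>) z" if "z \<in> \<Omega>" for z
  proof -
    have "du (du h) z = dv (dv h) z" "du (du L) z = dv (dv L) z" "du (du P) z = dv (dv P) z"
      using \<open>L_harmonic_on \<Omega> h\<close> du_du_eq_dv_dv[OF S that] Ck2 assms that
      by (auto simp: L_harmonic_on_def)
    then show ?thesis
      using DD\<psi>[OF that] by (simp add: du_def[abs_def] dv_def[abs_def])
  qed
  have metric: "lor (du \<psi> z) (du \<psi> z) = - lor (dv \<psi> z) (dv \<psi> z)" "lor (du \<psi> z) (dv \<psi> z) = 0"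
    "lor (du \<psi> z) (du \<psi> z) \<noteq> 0" if z: "z \<in> \<Omega>" for z
  proof -
    obtain \<alpha> \<beta> where h: "du h z = \<alpha>" "dv h z = \<beta>" by simp
    \<comment> \<open>The components of \<open>dv L z\<close> are named in reverse, so that
      \<open>du L z\<close>, and with it \<open>dz L z\<close>, becomes
      \<open>Paracomplex a b\<close>; likewise for \<open>P\<close>.\<close>
    obtain a b where L: "dv L z = Paracomplex b a" by (metis paracomplex.collapse)
    obtain c d where P: "dv P z = Paracomplex d c" by (metis paracomplex.collapse)
    have "du L z = tau * dv L z" "du P z = tau * dv P z"
      using assms(8,10) z by (auto simp: L_differentiable_on_def dzbar_def)
    then have LP: "du L z = Paracomplex a b" "du P z = Paracomplex c d"
      by (simp_all add: L P paracomplex_eq_iff)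
    have "bounded_linear (of_real :: real \<Rightarrow> paracomplex)"
      by (rule bounded_linear_of_real)
    then have "frechet_derivative (\<lambda>w. of_real (h w) :: paracomplex) (at z) v = of_real (frechet_derivative h (at z) v)" for v
      using smooth_on_has_derivative[OF assms(5) z]
      by (subst frechet_derivative_bounded_linear) (auto intro: differentiableI)
    then have dz: "dz (\<lambda>w. of_real (h w)) z = Paracomplex (\<alpha> / 2) (\<beta> / 2)"
      "dz L z = Paracomplex a b" "dz P z = Paracomplex c d"
      using h by (simp_all add: dz_def LP L P) (simp_all add: paracomplex_eq_iff of_real_def du_def dv_def)
    have \<psi>z: "du \<psi> z = vector [\<alpha>, a - c, b + d]" "dv \<psi> z = vector [\<beta>, b - d, a + c]"
      using h L P LP by (simp_all add: du_def dv_def D\<psi>[OF z] T_defs vec_eq_iff forall_3)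
    \<comment> \<open>The real part (times 4) and the \<open>tau\<close> part (times 2) of
      \<open>(h_z)^2 = L_z P_z\<close>.\<close>
    have hLP: "\<alpha>\<^sup>2 + \<beta>\<^sup>2 = 4 * (a * c + b * d)" "\<alpha> * \<beta> = 2 * (a * d + b * c)"
      using assms(11)[OF z] by (simp_all add: dz paracomplex_eq_iff power2_eq_square field_simps)
    \<comment> \<open>A product \<open>w * pconj w\<close> is the real number
      \<open>(PRe w)^2 - (PIm w)^2\<close>, so only the real part of the hypothesis can be
      nonzero.\<close>
    have nz: "(\<alpha>\<^sup>2 - \<beta>\<^sup>2) / 2 + (a\<^sup>2 - b\<^sup>2) + (c\<^sup>2 - d\<^sup>2) \<noteq> 0"
    proof
      assume "(\<alpha>\<^sup>2 - \<beta>\<^sup>2) / 2 + (a\<^sup>2 - b\<^sup>2) + (c\<^sup>2 - d\<^sup>2) = 0"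
      moreover have "PRe 2 = 2" "PIm 2 = 0"
        by (simp_all only: one_add_one[symmetric] plus_paracomplex.simps one_paracomplex.simps add_0_left)
      ultimately show False
        using assms(12)[OF z]
        by (simp add: dz pconj_def paracomplex_eq_iff power2_eq_square field_simps)
    qed
    \<comment> \<open>Expanding leaves the cross term \<open>- 2 (a c + b d)\<close>, which
      \<open>hLP\<close> turns into \<open>- (\<alpha>^2 + \<beta>^2) / 2\<close>.\<close>
    have E: "lor (du \<psi> z) (du \<psi> z) = (\<alpha>\<^sup>2 - \<beta>\<^sup>2) / 2 + (a\<^sup>2 - b\<^sup>2) + (c\<^sup>2 - d\<^sup>2)"
      using hLP(1) by (simp add: \<psi>z lor_def power2_eq_square field_simps)
    with nz show "lor (du \<psi> z) (du \<psi> z) \<noteq> 0" by simp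
    show "lor (du \<psi> z) (du \<psi> z) = - lor (dv \<psi> z) (dv \<psi> z)"
      using hLP(1) by (simp add: \<psi>z lor_def power2_eq_square algebra_simps)
    show "lor (du \<psi> z) (dv \<psi> z) = 0"
      using hLP(2) by (simp add: \<psi>z lor_def algebra_simps)
  qed
  have "conformal_timelike_minimal_immersion_on \<Omega> \<psi>"
    using S smooth metric wave by (intro isothermal_minimal) (auto simp: conformal_on_def)
  then show ?thesis by (simp add: \<psi>_def[abs_def])
qed

end
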